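(* For $n\ge1$ let $$\mathbf{a}_n=\frac{1}{2n}\sum_{d\mid n}\mu(n/d)\binom{2d}{d},\qquad \lambda(n)=(-1)^{\binom n2}\binom{n-1}{\lceil (n-1)/2\rceil},\qquad \mathbf{b}_n=\frac1n\sum_{d\mid n}\mu(d)\lambda(n/d),$$ where $\mu$ is the Möbius function. Then, as formal power series in $x$ (all products being over integers $n\ge1$ satisfying the indicated congruence), $$\prod_{n\ge1}(1-x^n)^{-\mathbf{a}_n}=\prod_{n\equiv0\ (\mathrm{mod}\ 4)}(1-x^n)^{-2\mathbf{b}_{2n}}\ \prod_{n\equiv2\ (\mathrm{mod}\ 4)}(1-x^n)^{-2\mathbf{b}_{2n}-2\mathbf{b}_n-\mathbf{b}_{n/2}}\ \prod_{n\equiv1\ (\mathrm{mod}\ 2)}(1-x^n)^{2\mathbf{b}_{2n}+\mathbf{b}_n}.$$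
   Context: The numbers $\mathbf{a}_n$ are positive integers ($1,1,3,8,25,\dots$) and the $\mathbf{b}_n$ are integers ($1,-1,-1,1,1,-1,-3,4,\dots$); in any case, powers of $1-x^n$ make sense as formal binomial series for rational exponents. *)

theory Defs
  imports "HOL-Analysis.Analysis" "HOL-Computational_Algebra.Squarefree"
begin

definition moebius :: "nat \<Rightarrow> int" where
  "moebius n = (if squarefree n then (-1) ^ card (prime_factors n) else 0)"

definition bold_a :: "nat \<Rightarrow> rat" where
  "bold_a n = 1 / (2 * of_nat n) *
     (\<Sum>d | d dvd n. of_int (moebius (n div d)) * of_nat ((2 * d) choose d))"

definition lam :: "nat \<Rightarrow> int" where
  "lam n = (-1) ^ (n choose 2) * int ((n - 1) choose nat \<lceil>of_nat (n - 1) / (2 :: rat)\<rceil>)"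

definition bold_b :: "nat \<Rightarrow> rat" where
  "bold_b n = 1 / of_nat n * (\<Sum>d | d dvd n. of_int (moebius d * lam (n div d)))"

text \<open>The power \<open>(1 - x ^ n) ^ c\<close> is the binomial series of \<open>(1 + y) ^ c\<close> composed with
  \<open>y = - x ^ n\<close>. The composition is meaningful only for \<open>n \<ge> 1\<close>.\<close>

definition one_minus_X_power_powr :: "nat \<Rightarrow> rat \<Rightarrow> rat fps" where
  "one_minus_X_power_powr n c = fps_compose (fps_binomial c) (- (fps_X ^ n))"

text \<open>The factors of the product of \<open>(1 - x ^ n) ^ (e n)\<close> over \<open>n \<in> S\<close>, padded with \<open>1\<close>
  outside \<open>S\<close> so that the library's infinite products over all natural numbers apply. Their
  convergence is with respect to the metric of \<^typ>\<open>rat fps\<close>, i.e. coefficientwise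
  stabilisation.\<close>

definition factors_over :: "nat set \<Rightarrow> (nat \<Rightarrow> rat) \<Rightarrow> nat \<Rightarrow> rat fps" where
  "factors_over S e n = (if n \<in> S then one_minus_X_power_powr n (e n) else 1)"

end

theory Submission
  imports Defs
begin

text \<open>
  The identity holds factor by factor: for every \<open>n\<close> the exponent of \<open>1 - x ^ n\<close> is the same on
  both sides. Since the three residue conditions on the right partition the positive integers,
  this makes every factor on the left the product of the three corresponding
  (padded) factors on the right, and it only remains to multiply convergent products.

  Put \<open>A n = (2 * n choose n) / 2\<close>. Then \<open>n * bold_a n\<close> and \<open>n * bold_b n\<close> are the Dirichlet
  convolutions of the Moebius function with \<open>A\<close> and with \<open>lam\<close>. The two are tied together by
  \<open>lam (2 * m) = (-1) ^ m * A m\<close> (lemma \<open>lam_double\<close>), so everything depends on how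
  a convolution with the Moebius function behaves when its argument is doubled. Write \<open>M f n\<close> for
  the sum of \<open>\<mu> d * f (n div d)\<close> over the divisors \<open>d\<close> of \<open>n\<close>, and \<open>f\<^sub>2\<close> for the sequence
  \<open>f\<^sub>2 j = f (2 * j)\<close>. If \<open>n\<close> is even, then no divisor of \<open>2 * n\<close> with nonzero \<open>\<mu>\<close>
  is divisible by \<open>4\<close>, and \<open>M f (2 * n) = M f\<^sub>2 n\<close>; if \<open>n\<close> is odd, then the divisors \<open>2 * d\<close>
  contribute with the opposite sign and \<open>M f (2 * n) = M f\<^sub>2 n - M f n\<close>.
  Applying these rules to \<open>lam\<close>, to \<open>A\<close> and to its signed version \<open>lam\<^sub>2\<close> expresses \<open>bold_a\<close>
  through \<open>bold_b\<close> in each residue class modulo \<open>4\<close>, and the results are the stated exponents.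
\<close>

section \<open>Convolution with the Moebius function\<close>

definition moebius_conv :: "(nat \<Rightarrow> rat) \<Rightarrow> nat \<Rightarrow> rat" where
  "moebius_conv f n = (\<Sum>d | d dvd n. of_int (moebius d) * f (n div d))"

lemma moebius_conv_cong:
  assumes "n > 0" "\<And>j. j dvd n \<Longrightarrow> f j = g j"
  shows "moebius_conv f n = moebius_conv g n"
  unfolding moebius_conv_def
proof (rule sum.cong [OF refl])
  fix d assume "d \<in> {d. d dvd n}"
  then have "n div d dvd n"
    by (auto elim!: dvdE)
  then show "of_int (moebius d) * f (n div d) = of_int (moebius d) * g (n div d)"
    using assms by simp
qed

lemma moebius_conv_uminus: "moebius_conv (\<lambda>j. - f j) n = - moebius_conv f n"
  by (simp add: moebius_conv_def sum_negf)

lemma moebius_four_dvd: "4 dvd d \<Longrightarrow> moebius d = 0"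
  using not_squarefreeI [of "2 :: nat" d] by (simp add: moebius_def)

lemma moebius_double_odd:
  assumes "odd d"
  shows "moebius (2 * d) = - moebius d"
proof -
  have cop: "coprime 2 d"
    using assms by simp
  have d0: "d \<noteq> 0"
    using assms by (auto intro: ccontr)
  have sf: "squarefree (2 * d) \<longleftrightarrow> squarefree d"
    using squarefree_mult_coprime [OF cop] squarefree_prime [of "2 :: nat"]
      squarefree_multD(2) [of 2 d]
    by auto
  have "prime_factors (2 * d) = prime_factors 2 \<union> prime_factors d"
    using d0 by (intro prime_factors_product) auto
  also have "prime_factors (2 :: nat) = {2}"
    by (simp add: prime_factorization_prime)
  finally have "prime_factors (2 * d) = insert 2 (prime_factors d)"
    by simp
  moreover have "2 \<notin> prime_factors d"
    using assms by (auto simp: in_prime_factors_iff)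
  ultimately have "card (prime_factors (2 * d)) = Suc (card (prime_factors d))"
    by simp
  then show ?thesis
    by (simp add: moebius_def sf)
qed

text \<open>A squarefree divisor of \<open>2 * n\<close> carries at most one factor \<open>2\<close>, which the even number
  \<open>n\<close> already contains.\<close>

lemma moebius_conv_double_even:
  assumes "n > 0" "even n"
  shows "moebius_conv f (2 * n) = moebius_conv (\<lambda>j. f (2 * j)) n"
proof -
  have *: "moebius d = 0" if d: "d dvd 2 * n" "\<not> d dvd n" for d
  proof -
    have "even d"
    proof (rule ccontr)
      assume "odd d"
      then have "coprime d 2" by simp
      then show False
        using d by (simp add: coprime_dvd_mult_right_iff)
    qed
    then obtain e where e: "d = 2 * e" ..
    obtain m where m: "n = 2 * m"
      using assms by blast
    have "e dvd 2 * m" "\<not> e dvd m"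
      using d by (auto simp: e m)
    then have "even e"
      by (metis coprime_dvd_mult_right_iff coprime_right_2_iff_odd)
    then show ?thesis
      by (auto simp: e intro!: moebius_four_dvd)
  qed
  have "moebius_conv f (2 * n) = (\<Sum>d | d dvd n. of_int (moebius d) * f (2 * n div d))"
    unfolding moebius_conv_def
    using assms * by (intro sum.mono_neutral_right) auto
  also have "\<dots> = moebius_conv (\<lambda>j. f (2 * j)) n"
    unfolding moebius_conv_def by (intro sum.cong) (auto simp: div_mult_swap)
  finally show ?thesis .
qed

text \<open>For odd \<open>n\<close> the divisors of \<open>2 * n\<close> are those of \<open>n\<close> together with their doubles, and
  doubling adds one prime factor.\<close>

lemma moebius_conv_double_odd:
  assumes "odd n"
  shows "moebius_conv f (2 * n) = moebius_conv (\<lambda>j. f (2 * j)) n - moebius_conv f n"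
proof -
  have n: "n > 0"
    using assms by (auto intro: ccontr)
  have divs: "{d. d dvd 2 * n} = {d. d dvd n} \<union> (*) 2 ` {d. d dvd n}"
  proof (intro equalityI subsetI)
    fix d assume d: "d \<in> {d. d dvd 2 * n}"
    show "d \<in> {d. d dvd n} \<union> (*) 2 ` {d. d dvd n}"
    proof (cases "even d")
      case True
      then show ?thesis
        using d by (auto elim!: evenE)
    next
      case False
      then have "coprime d 2" by simp
      then show ?thesis
        using d by (simp add: coprime_dvd_mult_right_iff)
    qed
  qed auto
  have "moebius_conv f (2 * n) =
      (\<Sum>d | d dvd n. of_int (moebius d) * f (2 * n div d)) +
      (\<Sum>d \<in> (*) 2 ` {d. d dvd n}. of_int (moebius d) * f (2 * n div d))"
    unfolding moebius_conv_def divs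
    using n assms by (intro sum.union_disjoint) (auto dest: dvd_mult_left)
  also have "(\<Sum>d | d dvd n. of_int (moebius d) * f (2 * n div d)) =
      moebius_conv (\<lambda>j. f (2 * j)) n"
    unfolding moebius_conv_def by (intro sum.cong) (auto simp: div_mult_swap)
  also have "(\<Sum>d \<in> (*) 2 ` {d. d dvd n}. of_int (moebius d) * f (2 * n div d)) =
      (\<Sum>d | d dvd n. of_int (moebius (2 * d)) * f (n div d))"
    by (subst sum.reindex) (auto simp: inj_on_def)
  also have "\<dots> = (\<Sum>d | d dvd n. - (of_int (moebius d) * f (n div d)))"
  proof (rule sum.cong [OF refl])
    fix d assume "d \<in> {d. d dvd n}"
    then have "odd d"
      using assms by auto
    then show "of_int (moebius (2 * d)) * f (n div d) = - (of_int (moebius d) * f (n div d))"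
      by (simp add: moebius_double_odd)
  qed
  also have "\<dots> = - moebius_conv f n"
    by (simp add: moebius_conv_def sum_negf)
  finally show ?thesis
    by simp
qed

section \<open>Comparison of the exponents\<close>

definition half_central_binomial :: "nat \<Rightarrow> rat" where
  "half_central_binomial n = of_nat ((2 * n) choose n) / 2"

lemma bold_a_conv:
  assumes "n > 0"
  shows "of_nat n * bold_a n = moebius_conv half_central_binomial n"
proof -
  have "of_nat n * bold_a n =
      (\<Sum>d | d dvd n. of_int (moebius (n div d)) * half_central_binomial d)"
    using assms by (simp add: bold_a_def half_central_binomial_def flip: sum_divide_distrib)
  also have "\<dots> = (\<Sum>d | d dvd n. of_int (moebius d) * half_central_binomial (n div d))"
    using assms
    by (intro sum.reindex_bij_witness [of _ "\<lambda>d. n div d" "\<lambda>d. n div d"]) (auto elim!: dvdE)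
  finally show ?thesis
    by (simp add: moebius_conv_def)
qed

lemma bold_b_conv:
  assumes "n > 0"
  shows "of_nat n * bold_b n = moebius_conv (\<lambda>j. of_int (lam j)) n"
  using assms by (simp add: bold_b_def moebius_conv_def)

text \<open>The middle of row \<open>2 * m\<close> of Pascal's triangle is the sum of the two equal middle entries
  of the row above it, one of which is the binomial coefficient in \<open>lam (2 * m)\<close>.\<close>

lemma lam_double:
  assumes "m > 0"
  shows "of_int (lam (2 * m)) = (-1) ^ m * half_central_binomial m"
proof -
  obtain k where k: "m = Suc k"
    using assms gr0_implies_Suc by blast
  define r where "r = 2 * m - 1"
  have "of_nat r / 2 = (of_nat m - 1 / 2 :: rat)"
    by (simp add: r_def k field_simps)
  then have ceil: "nat \<lceil>of_nat r / (2 :: rat)\<rceil> = m"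
    by (simp add: ceiling_eq_iff nat_eq_iff)
  have "(2 * m) choose m = (r choose (m - 1)) + (r choose m)"
    by (simp add: r_def k)
  also have "r choose (m - 1) = r choose m"
    using assms by (subst binomial_symmetric) (auto simp: r_def)
  finally have mid: "(2 * m) choose m = 2 * (r choose m)"
    by simp
  have "(2 * m) choose 2 = m * r"
    by (simp add: choose_two r_def)
  then have sgn: "(-1 :: rat) ^ ((2 * m) choose 2) = (-1) ^ m"
    using assms by (simp add: minus_one_power_iff r_def)
  show ?thesis
    unfolding lam_def r_def [symmetric]
    by (simp add: ceil half_central_binomial_def mid sgn)
qed

lemma bold_b_double_conv:
  assumes "n > 0" "even n"
  shows "of_nat (2 * n) * bold_b (2 * n) = moebius_conv (\<lambda>j. (-1) ^ j * half_central_binomial j) n"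
proof -
  have "of_nat (2 * n) * bold_b (2 * n) = moebius_conv (\<lambda>j. of_int (lam (2 * j))) n"
    using assms by (subst bold_b_conv) (auto intro: moebius_conv_double_even)
  also have "\<dots> = moebius_conv (\<lambda>j. (-1) ^ j * half_central_binomial j) n"
    using assms by (intro moebius_conv_cong lam_double) (auto intro: dvd_pos_nat)
  finally show ?thesis .
qed

text \<open>The convolution at an odd number only sees odd arguments, where the sign in
  \<open>lam (2 * j)\<close> is constantly \<open>-1\<close>.\<close>

lemma moebius_conv_alternating_odd:
  assumes "odd n"
  shows "moebius_conv (\<lambda>j. (-1) ^ j * half_central_binomial j) n =
    - moebius_conv half_central_binomial n"
proof -
  have "moebius_conv (\<lambda>j. (-1) ^ j * half_central_binomial j) n =
      moebius_conv (\<lambda>j. - half_central_binomial j) n"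
  proof (rule moebius_conv_cong)
    show "n > 0"
      using assms by (auto intro: ccontr)
    fix j assume "j dvd n"
    then have "odd j"
      using assms by auto
    then show "(-1) ^ j * half_central_binomial j = - half_central_binomial j"
      by simp
  qed
  then show ?thesis
    by (simp add: moebius_conv_uminus)
qed

lemma bold_a_odd:
  assumes "odd n"
  shows "bold_a n = - 2 * bold_b (2 * n) - bold_b n"
proof -
  have n: "n > 0"
    using assms by (auto intro: ccontr)
  have "of_nat (2 * n) * bold_b (2 * n) =
      moebius_conv (\<lambda>j. of_int (lam (2 * j))) n - of_nat n * bold_b n"
    using n moebius_conv_double_odd [OF assms, of "\<lambda>j. of_int (lam j)"]
    by (simp add: bold_b_conv del: of_nat_mult)
  also have "moebius_conv (\<lambda>j. of_int (lam (2 * j))) n =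
      moebius_conv (\<lambda>j. (-1) ^ j * half_central_binomial j) n"
    using n by (intro moebius_conv_cong lam_double) (auto intro: dvd_pos_nat)
  also have "\<dots> = - (of_nat n * bold_a n)"
    using n by (simp add: moebius_conv_alternating_odd [OF assms] bold_a_conv)
  finally have "of_nat n * bold_a n = of_nat n * (- 2 * bold_b (2 * n) - bold_b n)"
    by (simp add: algebra_simps)
  then show ?thesis
    using n by simp
qed

text \<open>Here the sign in \<open>lam (2 * j)\<close> does vary over the divisors of \<open>n\<close>; doubling the
  odd number \<open>n div 2\<close> for both the signed and the unsigned sequence shows that the signs change
  the convolution by twice its value at \<open>n div 2\<close>.\<close>

lemma bold_a_2_mod_4:
  assumes "n mod 4 = 2"
  shows "bold_a n = 2 * bold_b (2 * n) + 2 * bold_b n + bold_b (n div 2)"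
proof -
  define k where "k = n div 2"
  have n: "n = 2 * k" and k: "odd k"
    using assms unfolding k_def by presburger+
  have k0: "k > 0"
    using k by (auto intro: ccontr)
  let ?H = "moebius_conv (\<lambda>j. half_central_binomial (2 * j)) k"
  have "of_nat (2 * n) * bold_b (2 * n) = ?H + of_nat k * bold_a k"
    using k0 k bold_b_double_conv [of n]
    by (simp add: n moebius_conv_double_odd moebius_conv_alternating_odd bold_a_conv)
  moreover have "of_nat n * bold_a n = ?H - of_nat k * bold_a k"
    using k0 k bold_a_conv [of n]
    by (simp add: n moebius_conv_double_odd bold_a_conv)
  ultimately have "of_nat n * bold_a n =
      of_nat (2 * n) * bold_b (2 * n) - 2 * of_nat k * (- 2 * bold_b n - bold_b k)"
    using bold_a_odd [OF k] by (simp add: n algebra_simps)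
  then have "of_nat n * bold_a n = of_nat n * (2 * bold_b (2 * n) + 2 * bold_b n + bold_b k)"
    by (simp add: n algebra_simps)
  then show ?thesis
    using k0 by (simp add: n)
qed

text \<open>Doubling the even number \<open>n div 2\<close> leaves only even arguments, where the sign in
  \<open>lam (2 * j)\<close> disappears.\<close>

lemma bold_a_0_mod_4:
  assumes "n > 0" "n mod 4 = 0"
  shows "bold_a n = 2 * bold_b (2 * n)"
proof -
  define m where "m = n div 2"
  have n: "n = 2 * m" and m: "even m" "m > 0"
    using assms unfolding m_def by presburger+
  have "of_nat n * (2 * bold_b (2 * n)) = of_nat n * bold_a n"
    using m bold_b_double_conv [of n] bold_a_conv [of n]
    by (simp add: n moebius_conv_double_even power_mult)
  then show ?thesis
    using m by (simp add: n)
qed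

section \<open>Coefficientwise convergent products of power series\<close>

lemma tendsto_mult_fps:
  fixes p q :: "'a :: ring_1 fps"
  assumes "(f \<longlongrightarrow> p) F" "(g \<longlongrightarrow> q) F"
  shows "((\<lambda>x. f x * g x) \<longlongrightarrow> p * q) F"
proof (rule tendsto_fpsI)
  fix n
  have "\<forall>\<^sub>F x in F. \<forall>i\<in>{..n}. fps_nth (f x) i = fps_nth p i \<and> fps_nth (g x) i = fps_nth q i"
    using assms by (intro eventually_ball_finite ballI eventually_conj) (auto simp: tendsto_fps_iff)
  then show "\<forall>\<^sub>F x in F. fps_nth (f x * g x) n = fps_nth (p * q) n"
    by eventually_elim (auto simp: fps_mult_nth intro!: sum.cong)
qed

lemma raw_has_prod_mult_fps:
  fixes p q :: "'a :: idom fps"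
  assumes "raw_has_prod f M p" "raw_has_prod g M q"
  shows "raw_has_prod (\<lambda>n. f n * g n) M (p * q)"
  using assms by (auto simp: raw_has_prod_def prod.distrib intro!: tendsto_mult_fps)

text \<open>The factors beyond the \<open>n\<close>-th do not touch the coefficient of \<open>x ^ n\<close>, so the partial
  products stabilise in every coefficient. The limit is nonzero because its constant term is that
  of \<open>f 0\<close>.\<close>

lemma raw_has_prod_fps:
  fixes f :: "nat \<Rightarrow> 'a :: idom fps"
  assumes f: "\<And>k m. m < k \<Longrightarrow> fps_nth (f k) m = fps_nth 1 m" and f0: "fps_nth (f 0) 0 \<noteq> 0"
  shows "\<exists>p. raw_has_prod f 0 p"
proof -
  define p where "p = Abs_fps (\<lambda>n. fps_nth (\<Prod>k\<le>n. f k) n)"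
  have stable: "fps_nth (\<Prod>k\<le>N. f k) n = fps_nth p n" if "n \<le> N" for n N
    using that
  proof (induction N rule: dec_induct)
    case base
    then show ?case
      by (simp add: p_def)
  next
    case (step N)
    have "fps_nth (\<Prod>k\<le>Suc N. f k) n = (\<Sum>i=0..n. fps_nth (\<Prod>k\<le>N. f k) i * fps_nth (f (Suc N)) (n - i))"
      by (simp add: fps_mult_nth)
    also have "\<dots> = (\<Sum>i=0..n. fps_nth (\<Prod>k\<le>N. f k) i * fps_nth 1 (n - i))"
      using step by (intro sum.cong) (auto simp: f)
    also have "\<dots> = fps_nth ((\<Prod>k\<le>N. f k) * 1) n"
      by (simp only: fps_mult_nth)
    finally show ?case
      using step by simp
  qed
  have "(\<lambda>N. \<Prod>k\<le>N. f k) \<longlonglongrightarrow> p"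
    by (intro tendsto_fpsI eventually_sequentiallyI) (rule stable)
  moreover have "fps_nth p 0 \<noteq> 0"
    using f0 by (simp add: p_def)
  then have "p \<noteq> 0"
    by auto
  ultimately show ?thesis
    by (auto simp: raw_has_prod_def)
qed

lemma one_minus_X_power_powr_nth:
  assumes "m < n"
  shows "fps_nth (one_minus_X_power_powr n c) m = fps_nth 1 m"
proof -
  have "fps_nth ((- (fps_X ^ n :: rat fps)) ^ i) m = (if i = 0 then fps_nth 1 m else 0)" if "i \<in> {0..m}" for i
  proof (cases "i = 0")
    case False
    then have "m < n * i"
      using assms by (metis less_le_trans mult.right_neutral mult_le_mono2 not_gr_zero Suc_leI One_nat_def)
    then show ?thesis
      using False by (cases "even i") (simp_all add: power_mult [symmetric])
  qed simp
  then have "fps_nth (one_minus_X_power_powr n c) m =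
      (\<Sum>i=0..m. fps_nth (fps_binomial c) i * (if i = 0 then fps_nth 1 m else 0))"
    unfolding one_minus_X_power_powr_def fps_compose_nth by (intro sum.cong) auto
  also have "\<dots> = fps_nth 1 m"
    by (simp add: if_distrib cong: if_cong)
  finally show ?thesis .
qed

lemma raw_has_prod_factors_over:
  assumes "0 \<notin> S"
  shows "\<exists>p. raw_has_prod (factors_over S e) 0 p"
  using assms by (intro raw_has_prod_fps) (auto simp: factors_over_def one_minus_X_power_powr_nth)

section \<open>The product identity\<close>

theorem proposition5p1:
  defines "L \<equiv> factors_over {n. n \<ge> 1} (\<lambda>n. - bold_a n)"
    and "R0 \<equiv> factors_over {n. n \<ge> 1 \<and> n mod 4 = 0} (\<lambda>n. - 2 * bold_b (2 * n))"
    and "R2 \<equiv> factors_over {n. n \<ge> 1 \<and> n mod 4 = 2}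
                (\<lambda>n. - 2 * bold_b (2 * n) - 2 * bold_b n - bold_b (n div 2))"
    and "R1 \<equiv> factors_over {n. n \<ge> 1 \<and> n mod 2 = 1} (\<lambda>n. 2 * bold_b (2 * n) + bold_b n)"
  shows "convergent_prod L \<and> convergent_prod R0 \<and> convergent_prod R2 \<and> convergent_prod R1 \<and>
         (\<Prod>n. L n) = (\<Prod>n. R0 n) * (\<Prod>n. R2 n) * (\<Prod>n. R1 n)"
proof -
  obtain p0 where p0: "raw_has_prod R0 0 p0"
    using raw_has_prod_factors_over unfolding R0_def by fastforce
  obtain p2 where p2: "raw_has_prod R2 0 p2"
    using raw_has_prod_factors_over unfolding R2_def by fastforce
  obtain p1 where p1: "raw_has_prod R1 0 p1"
    using raw_has_prod_factors_over unfolding R1_def by fastforce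
  have "L n = R0 n * R2 n * R1 n" for n
  proof -
    consider "n = 0" | "n > 0" "n mod 4 = 0" | "n mod 4 = 2" | "odd n"
      by atomize_elim presburger
    then show ?thesis
    proof cases
      case 1
      then show ?thesis
        by (simp add: L_def R0_def R2_def R1_def factors_over_def)
    next
      case 2
      then have "even n" by presburger
      with 2 show ?thesis
        by (simp add: L_def R0_def R2_def R1_def factors_over_def bold_a_0_mod_4)
    next
      case 3
      then have "even n" "n > 0" by presburger+
      moreover have "- bold_a n = - 2 * bold_b (2 * n) - 2 * bold_b n - bold_b (n div 2)"
        using bold_a_2_mod_4 [OF 3] by simp
      ultimately show ?thesis
        using 3 by (simp add: L_def R0_def R2_def R1_def factors_over_def)
    next
      case 4
      then have "n mod 4 \<noteq> 0" "n mod 4 \<noteq> 2" "n > 0" by presburger+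
      moreover have "- bold_a n = 2 * bold_b (2 * n) + bold_b n"
        using bold_a_odd [OF 4] by simp
      ultimately show ?thesis
        using 4 by (simp add: L_def R0_def R2_def R1_def factors_over_def odd_iff_mod_2_eq_one)
    qed
  qed
  then have "L = (\<lambda>n. R0 n * R2 n * R1 n)" ..
  then have pL: "raw_has_prod L 0 (p0 * p2 * p1)"
    using p0 p2 p1 by (simp add: raw_has_prod_mult_fps)
  have "prodinf f = p" if "raw_has_prod f 0 p" for f and p :: "rat fps"
    using that by (metis has_prod_def has_prod_unique)
  then show ?thesis
    using p0 p2 p1 pL by (auto simp: convergent_prod_def)
qed

end
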